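(* For every $n\in\mathbb{N}$, $$\prod_{k\in\mathrm{Reg}_n}k=n^{\varrho(n)}\prod_{d\,\|\,n}A(d),$$ where $A(m)=\prod_{d\mid m}\left(d!/d^d\right)^{\mu(m/d)}$ for $m\in\mathbb{N}$.
   Context: $\mathbb{N}=\{1,2,\ldots\}$. An integer $k$ is called regular (mod $n$) if there exists $x\in\mathbb{Z}$ with $k^2x\equiv k\pmod n$, $\mathrm{Reg}_n=\{k\in\mathbb{N}:1\le k\le n,\ k\text{ is regular (mod }n)\}$, and $\varrho(n)=\#\mathrm{Reg}_n$. $d\,\|\,n$ means that $d$ is a unitary divisor of $n$, i.e. $d\ge1$, $d\mid n$ and $\gcd(d,n/d)=1$. $\mu$ is the Möbius function. *)

theory Defs
  imports Complex_Main "HOL-Number_Theory.Number_Theory"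
    "HOL-Computational_Algebra.Squarefree"
begin

definition regular_mod :: "nat \<Rightarrow> int \<Rightarrow> bool" where
  "regular_mod n k \<longleftrightarrow> (\<exists>x::int. [k\<^sup>2 * x = k] (mod int n))"

definition Reg :: "nat \<Rightarrow> nat set" where
  "Reg n = {k. 1 \<le> k \<and> k \<le> n \<and> regular_mod n (int k)}"

definition num_reg :: "nat \<Rightarrow> nat" where
  "num_reg n = card (Reg n)"

definition unitary_divisor :: "nat \<Rightarrow> nat \<Rightarrow> bool" where
  "unitary_divisor d n \<longleftrightarrow> 1 \<le> d \<and> d dvd n \<and> gcd d (n div d) = 1"

text \<open>The Moebius function; the value at 0 is 0 and is never used.\<close>

definition moebius :: "nat \<Rightarrow> int" where
  "moebius n = (if squarefree n then (-1) ^ card (prime_factors n) else 0)"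

text \<open>The exponent can be negative, hence the integer power \<open>powi\<close>. For \<open>m = 0\<close> the divisor
  set is infinite and the value is meaningless.\<close>

definition A_fun :: "nat \<Rightarrow> real" where
  "A_fun m = (\<Prod>d | d dvd m. (fact d / real d ^ d) powi moebius (m div d))"

end

theory Submission
  imports Defs
begin

text \<open>An integer \<open>k\<close> is regular mod \<open>n\<close> iff \<open>gcd(k, n)\<close> is a unitary divisor of \<open>n\<close>. Sorting
  \<open>Reg\<^sub>n\<close> by this gcd and dividing each \<open>k\<close> by \<open>n\<close> turns the product of \<open>k/n\<close> into the product over
  unitary divisors \<open>d\<close> of the products of \<open>j/d\<close> over the \<open>j \<le> d\<close> coprime to \<open>d\<close>. Moebius inversion
  of \<open>d!/d\<^sup>d\<close>, the product of \<open>j/d\<close> over all \<open>j \<le> d\<close>, shows that the latter products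
  are \<open>A(d)\<close>.\<close>

lemma moebius_prime_times:
  assumes "prime p" "\<not> p dvd d" "d > 0"
  shows "moebius (p * d) = - moebius d"
proof -
  have cop: "coprime p d"
    using assms by (simp add: prime_imp_coprime)
  have "squarefree (p * d) \<longleftrightarrow> squarefree d"
    using squarefree_mult_coprime[OF cop squarefree_prime[OF assms(1)]] squarefree_multD(2)[of p d]
    by blast
  moreover have "prime_factors (p * d) = insert p (prime_factors d)"
    using assms by (simp add: prime_factors_product prime_prime_factors prime_gt_0_nat)
  moreover have "p \<notin> prime_factors d"
    using assms(2) by auto
  ultimately show ?thesis
    by (simp add: moebius_def)
qed

lemma moebius_prime_times_dvd:
  assumes "prime p" "p dvd d"
  shows "moebius (p * d) = 0"
proof -
  have "p ^ 2 dvd p * d"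
    using assms(2) by (simp add: power2_eq_square)
  then have "\<not> squarefree (p * d)"
    using assms(1) by (metis not_prime_unit squarefree_def)
  then show ?thesis
    by (simp add: moebius_def)
qed

text \<open>Fix a prime \<open>p\<close> dividing \<open>n\<close>. Multiplication by \<open>p\<close> pairs the divisors prime to \<open>p\<close> with
  divisors of opposite sign, and the remaining divisors are divisible by \<open>p\<^sup>2\<close>.\<close>

lemma sum_moebius_divisors:
  assumes "n > 0"
  shows "(\<Sum>d | d dvd n. moebius d) = (if n = 1 then 1 else 0)"
proof (cases "n = 1")
  case True
  then show ?thesis by (simp add: moebius_def)
next
  case False
  then obtain p where p: "prime p" "p dvd n"
    using prime_factor_nat by blast
  define S where "S = {d. d dvd n \<and> \<not> p dvd d}"
  have fin: "finite {d. d dvd n}"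
    using assms by simp
  have finS: "finite S"
    unfolding S_def using fin by (rule rev_finite_subset) auto
  have sub: "S \<union> (*) p ` S \<subseteq> {d. d dvd n}"
    using p by (auto simp: S_def intro!: divides_mult prime_imp_coprime)
  have "moebius d = 0" if d: "d \<in> {d. d dvd n} - (S \<union> (*) p ` S)" for d
  proof -
    have "p dvd d"
      using d by (auto simp: S_def)
    then obtain e where e: "d = p * e" ..
    have "e dvd n"
      using d e by (auto intro: dvd_trans[of e "p * e"])
    then have "p dvd e"
      using d e by (auto simp: S_def)
    then show ?thesis
      using e p by (simp add: moebius_prime_times_dvd)
  qed
  then have "(\<Sum>d | d dvd n. moebius d) = (\<Sum>d\<in>S \<union> (*) p ` S. moebius d)"
    using fin sub by (intro sum.mono_neutral_right) auto
  also have "\<dots> = (\<Sum>d\<in>S. moebius d) + (\<Sum>d\<in>(*) p ` S. moebius d)"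
    using finS by (intro sum.union_disjoint) (auto simp: S_def)
  also have "(\<Sum>d\<in>(*) p ` S. moebius d) = (\<Sum>d\<in>S. moebius (p * d))"
    using p by (subst sum.reindex) (auto simp: inj_on_def prime_gt_0_nat)
  also have "\<dots> = (\<Sum>d\<in>S. - moebius d)"
    using p assms by (intro sum.cong refl moebius_prime_times) (auto simp: S_def intro: dvd_pos_nat)
  finally show ?thesis
    using False by (simp add: sum_negf)
qed

lemma prod_powi_eq:
  fixes x :: "'a :: field"
  assumes "x \<noteq> 0"
  shows "(\<Prod>i\<in>I. x powi f i) = x powi (\<Sum>i\<in>I. f i)"
  using assms by (induction I rule: infinite_finite_induct) (auto simp: power_int_add)

lemma prod_powi_distrib:
  fixes f :: "'b \<Rightarrow> 'a :: field"
  shows "(\<Prod>i\<in>I. f i) powi z = (\<Prod>i\<in>I. f i powi z)"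
  by (induction I rule: infinite_finite_induct) (simp_all add: power_int_mult_distrib)

text \<open>The multiples of \<open>c\<close> up to \<open>m\<close> are \<open>c * j\<close> with
  \<open>j \<le> m div c\<close>, and \<open>c * j / m = j / (m div c)\<close>. This brings all
  factors of \<open>A_fun m\<close> to the common denominator \<open>m\<close>, so that the products
  over divisors and over \<open>k\<close> can be swapped.\<close>

lemma fact_over_power_eq_prod_multiples:
  assumes "m > 0" "c dvd m"
  shows "fact (m div c) / real (m div c) ^ (m div c) = (\<Prod>k | k \<in> {1..m} \<and> c dvd k. real k / real m)"
proof -
  obtain d where d: "m = c * d"
    using assms(2) ..
  have pos: "c > 0" "d > 0"
    using d assms(1) by simp_all
  have "{k. k \<in> {1..m} \<and> c dvd k} = (*) c ` {1..d}"
    using pos by (auto simp: d)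
  then have "(\<Prod>k | k \<in> {1..m} \<and> c dvd k. real k / real m) = (\<Prod>j\<in>{1..d}. real (c * j) / real m)"
    using pos by (simp add: prod.reindex inj_on_def)
  also have "\<dots> = (\<Prod>j\<in>{1..d}. real j / real d)"
    using pos by (simp add: d)
  also have "\<dots> = fact d / real d ^ d"
    by (simp add: prod_dividef fact_prod)
  finally show ?thesis
    using pos by (simp add: d)
qed

text \<open>The factor \<open>k/m\<close> occurs in \<open>A(m)\<close> with exponent the sum of \<open>\<mu>(c)\<close> over the divisors \<open>c\<close>
  of \<open>gcd(k, m)\<close>, which is 1 if \<open>k\<close> is coprime to \<open>m\<close> and 0 otherwise.\<close>

lemma A_fun_eq_prod_totatives:
  assumes "m > 0"
  shows "A_fun m = (\<Prod>k\<in>totatives m. real k / real m)"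
proof -
  let ?q = "\<lambda>k. real k / real m"
  have fin: "finite {c. c dvd m}"
    using assms by simp
  \<comment> \<open>Substitution of the complementary divisor \<open>c = m div d\<close>.\<close>
  have "A_fun m = (\<Prod>c | c dvd m. (fact (m div c) / real (m div c) ^ (m div c)) powi moebius c)"
    unfolding A_fun_def using assms
    by (intro prod.reindex_bij_witness[of _ "(div) m" "(div) m"]) (auto simp: div_dvd_iff_mult)
  also have "\<dots> = (\<Prod>c | c dvd m. \<Prod>k | k \<in> {1..m} \<and> c dvd k. ?q k powi moebius c)"
  proof (intro prod.cong refl)
    fix c assume "c \<in> {c. c dvd m}"
    then have "fact (m div c) / real (m div c) ^ (m div c) = (\<Prod>k | k \<in> {1..m} \<and> c dvd k. ?q k)"
      using assms by (intro fact_over_power_eq_prod_multiples) simp_all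
    then show "(fact (m div c) / real (m div c) ^ (m div c)) powi moebius c
        = (\<Prod>k | k \<in> {1..m} \<and> c dvd k. ?q k powi moebius c)"
      by (simp only: prod_powi_distrib)
  qed
  also have "\<dots> = (\<Prod>k\<in>{1..m}. \<Prod>c | c \<in> {c. c dvd m} \<and> c dvd k. ?q k powi moebius c)"
    using fin by (intro prod.swap_restrict) simp_all
  also have "\<dots> = (\<Prod>k\<in>{1..m}. if coprime k m then ?q k else 1)"
  proof (intro prod.cong refl)
    fix k assume k: "k \<in> {1..m}"
    have "(\<Sum>c | c \<in> {c. c dvd m} \<and> c dvd k. moebius c) = (\<Sum>c | c dvd gcd k m. moebius c)"
      by (intro sum.cong) auto
    also have "\<dots> = (if coprime k m then 1 else 0)"
      unfolding coprime_iff_gcd_eq_1 using assms by (intro sum_moebius_divisors) simp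
    finally have "?q k powi (\<Sum>c | c \<in> {c. c dvd m} \<and> c dvd k. moebius c) = (if coprime k m then ?q k else 1)"
      by (simp only: if_distrib[of "power_int _"] power_int_1_right power_int_0_right)
    \<comment> \<open>As \<open>k\<close> starts at 1, the base \<open>?q k\<close> is nonzero, so
      exponents add even when some are negative.\<close>
    moreover have "(\<Prod>c | c \<in> {c. c dvd m} \<and> c dvd k. ?q k powi moebius c)
        = ?q k powi (\<Sum>c | c \<in> {c. c dvd m} \<and> c dvd k. moebius c)"
      using k by (intro prod_powi_eq) auto
    ultimately show "(\<Prod>c | c \<in> {c. c dvd m} \<and> c dvd k. ?q k powi moebius c)
        = (if coprime k m then ?q k else 1)"
      by (rule trans[rotated])
  qed
  also have "\<dots> = (\<Prod>k\<in>{k\<in>{1..m}. coprime k m}. ?q k)"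
    by (rule prod.inter_filter[symmetric]) simp
  also have "{k\<in>{1..m}. coprime k m} = totatives m"
    by (auto simp: totatives_def)
  finally show ?thesis .
qed

text \<open>Write \<open>k = g * k'\<close> and \<open>n = g * m\<close> with \<open>k'\<close>
  coprime to \<open>m\<close>. Cancelling \<open>g\<close> and then \<open>k'\<close> turns the
  congruence into \<open>k * x = 1\<close> modulo \<open>m\<close>. So regularity means that
  \<open>k\<close> is invertible modulo \<open>m\<close>, that is, that \<open>g\<close> is coprime
  to \<open>m\<close>.\<close>

lemma regular_mod_iff_unitary_gcd:
  assumes "n > 0"
  shows "regular_mod n (int k) \<longleftrightarrow> unitary_divisor (gcd k n) n"
proof -
  define g where "g = gcd k n"
  have g: "g > 0"
    using assms by (simp add: g_def)
  obtain k' m where km: "k = g * k'" "n = g * m" "coprime k' m"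
    using g unfolding g_def
    by (metis gcd_coprime_exists mult.commute not_gr_zero)
  have "[(int k)\<^sup>2 * x = int k] (mod int n) \<longleftrightarrow> [int k * x = 1] (mod int m)" for x
  proof -
    have "(int k)\<^sup>2 * x - int k = int g * (int k' * (int k * x - 1))"
      by (simp add: km power2_eq_square algebra_simps)
    then have "[(int k)\<^sup>2 * x = int k] (mod int n) \<longleftrightarrow> int m dvd int k' * (int k * x - 1)"
      using g by (simp add: cong_iff_dvd_diff km)
    also have "\<dots> \<longleftrightarrow> int m dvd int k * x - 1"
      using km(3) by (intro coprime_dvd_mult_right_iff) (simp add: coprime_commute)
    finally show ?thesis
      by (simp add: cong_iff_dvd_diff)
  qed
  then have "regular_mod n (int k) \<longleftrightarrow> coprime (int k) (int m)"
    by (simp add: regular_mod_def coprime_iff_invertible_int)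
  also have "\<dots> \<longleftrightarrow> coprime g m"
    using km by simp
  also have "\<dots> \<longleftrightarrow> unitary_divisor g n"
    unfolding coprime_iff_gcd_eq_1 using g by (simp add: unitary_divisor_def km(2))
  finally show ?thesis
    by (simp add: g_def)
qed

lemma unitary_divisor_div:
  assumes "n > 0" "unitary_divisor d n"
  shows "unitary_divisor (n div d) n"
proof -
  obtain e where e: "n = d * e"
    using assms(2) unfolding unitary_divisor_def dvd_def by blast
  then have "d > 0" "e > 0" "gcd d e = 1"
    using assms by (simp_all add: unitary_divisor_def)
  then show ?thesis
    by (simp add: e unitary_divisor_def gcd.commute)
qed

theorem proposition5p5p1:
  fixes n :: nat
  assumes "n \<ge> 1"
  shows "(\<Prod>k\<in>Reg n. real k) = real n ^ num_reg n * (\<Prod>d | unitary_divisor d n. A_fun d)"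
proof -
  let ?U = "{d. unitary_divisor d n}"
  have n: "n > 0"
    using assms by simp
  have finU: "finite ?U"
    using n by (intro finite_subset[of ?U "{d. d dvd n}"]) (auto simp: unitary_divisor_def)
  have Reg: "Reg n = {k\<in>{0<..n}. unitary_divisor (gcd k n) n}"
    using n by (auto simp: Reg_def regular_mod_iff_unitary_gcd)
  have "(\<Prod>k\<in>Reg n. real k / real n) = (\<Prod>d\<in>?U. \<Prod>k\<in>{k\<in>Reg n. gcd k n = d}. real k / real n)"
    using finU by (intro prod.group[symmetric]) (auto simp: Reg)
  \<comment> \<open>The \<open>k \<le> n\<close> with gcd \<open>d\<close> are the
    \<open>j * d\<close> with \<open>j\<close> a totative of the complementary divisor
    \<open>n div d\<close>.\<close>
  also have "\<dots> = (\<Prod>d\<in>?U. \<Prod>j\<in>totatives (n div d). real j / real (n div d))"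
  proof (rule prod.cong[OF refl])
    fix d assume "d \<in> ?U"
    then have d: "unitary_divisor d n" "d dvd n" "d > 0"
      by (auto simp: unitary_divisor_def)
    have "{k\<in>Reg n. gcd k n = d} = {k\<in>{0<..n}. gcd k n = d}"
      using d by (auto simp: Reg)
    moreover have "bij_betw (\<lambda>k. k * d) (totatives (n div d)) {k\<in>{0<..n}. gcd k n = d}"
      using n d by (intro bij_betw_totatives_gcd_eq) auto
    ultimately have "(\<Prod>k\<in>{k\<in>Reg n. gcd k n = d}. real k / real n)
        = (\<Prod>j\<in>totatives (n div d). real (j * d) / real n)"
      by (simp add: prod.reindex_bij_betw[symmetric])
    also have "\<dots> = (\<Prod>j\<in>totatives (n div d). real j / real (n div d))"
      using d by (simp add: real_of_nat_div)
    finally show "(\<Prod>k\<in>{k\<in>Reg n. gcd k n = d}. real k / real n)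
        = (\<Prod>j\<in>totatives (n div d). real j / real (n div d))" .
  qed
  also have "\<dots> = (\<Prod>d\<in>?U. A_fun (n div d))"
    using n by (intro prod.cong refl A_fun_eq_prod_totatives[symmetric])
      (auto simp: unitary_divisor_def dvd_imp_le)
  \<comment> \<open>Passing to the complementary divisor is an involution on the unitary divisors of
    \<open>n\<close>.\<close>
  also have "\<dots> = (\<Prod>d\<in>?U. A_fun d)"
    using n by (intro prod.reindex_bij_witness[of _ "(div) n" "(div) n"])
      (auto simp: unitary_divisor_div, auto simp: unitary_divisor_def)
  finally have "(\<Prod>k\<in>Reg n. real k) / real n ^ num_reg n = (\<Prod>d\<in>?U. A_fun d)"
    by (simp add: prod_dividef num_reg_def)
  then show ?thesis
    using n by (simp add: field_simps)
qed

end
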